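(* Let $x_0,x_1$ be independent indeterminates and let $(x_n)_{n\ge 0}$ be defined by $x_{n+1}x_{n-1}=x_n^2+1$ for all $n\geq 1$. Set $$y_1=\frac{x_1}{x_0},\qquad y_2=\frac{1}{x_0x_1},\qquad y_3=\frac{x_0}{x_1}.$$ Then, as formal power series in $t$, $$\sum_{n\ge 0}t^n x_n=\cfrac{x_0}{1-t\cfrac{y_1}{1-t\cfrac{y_2}{1-t y_3}}}=\sum_{p,q,\ell\ge 0}\binom{p+q-1}{q}\binom{q+\ell-1}{\ell}\,t^{p+q+\ell}\,x_0^{1+\ell-p-q}\,x_1^{p-q-\ell}.$$ In particular every $x_n$, $n\ge 0$, is a Laurent polynomial in $x_0,x_1$ with non-negative integer coefficients.
   Context: This is the rank 2 affine cluster algebra recursion (with trivial coefficients) of type $(b,c)=(2,2)$. The $x_n$ are elements of the field of rational functions in $x_0,x_1$. Binomial convention: $\binom{-1}{0}=1$ and $\binom{N}{m}=0$ whenever $0\le N<m$. *)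

theory Defs
  imports "HOL-Analysis.Analysis" "HOL-Computational_Algebra.Computational_Algebra"
begin

text \<open>The field \<open>\<rat>(x\<^sub>0, x\<^sub>1)\<close> is the fraction field of \<open>\<rat>[x\<^sub>0][x\<^sub>1]\<close>: the inner polynomial
  variable is \<open>x\<^sub>0\<close>, the outer one is \<open>x\<^sub>1\<close>.\<close>

type_synonym ratfun2 = "rat poly poly fract"

definition X0 :: ratfun2 where
  "X0 = Fraction_Field.Fract [:[:0, 1:]:] 1"

definition X1 :: ratfun2 where
  "X1 = Fraction_Field.Fract [:0, 1:] 1"

text \<open>Only \<open>N \<ge> -1\<close> is ever used, and \<open>N = -1\<close> only together with \<open>m = 0\<close>.\<close>

definition binom :: "int \<Rightarrow> nat \<Rightarrow> nat" where
  "binom N m = (if N \<ge> 0 then nat N choose m else if m = 0 then 1 else 0)"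

text \<open>Since \<open>X0\<close> and \<open>X1\<close> are algebraically independent, the coefficient family \<open>c\<close> below is
  determined by \<open>f\<close>.\<close>

definition nonneg_int_Laurent_poly :: "ratfun2 \<Rightarrow> bool" where
  "nonneg_int_Laurent_poly f \<longleftrightarrow>
     (\<exists>c :: int \<times> int \<Rightarrow> int.
        finite {k. c k \<noteq> 0} \<and> (\<forall>k. c k \<ge> 0) \<and>
        f = (\<Sum>(i, j) \<in> {k. c k \<noteq> 0}. of_int (c (i, j)) * X0 powi i * X1 powi j))"

end

theory Submission
  imports Defs
begin

unbundle no vec_syntax

text \<open>
  The quantity \<open>(x (n + 1) + x (n - 1)) / x n\<close> is independent of \<open>n\<close> and equals \<open>y1 + y2 + y3\<close>.
  This conserved quantity turns the nonlinear recursion into a linear one, so the generating function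
  is rational, and, as \<open>y1 * y3 = 1\<close>, the continued fraction collapses to the same quotient.
  Dividing by \<open>x (n - 1)\<close> is legitimate since \<open>\<rat>(x\<^sub>0, x\<^sub>1)\<close> is an ordered field, in which \<open>z\<^sup>2 + 1 \<noteq> 0\<close>.
  The triple sum comes from applying the negative binomial series to the three nested levels in turn.
\<close>

section \<open>Negative binomial series and expansion of the continued fraction\<close>

lemma binom_negative_binomial_gbinomial:
  "of_nat (binom (int p + int i - 1) i) = (-1) ^ i * ((- of_nat p :: 'a::field_char_0) gchoose i)"
proof (cases "p + i")
  \<comment> \<open>Here \<open>p = i = 0\<close> and the upper entry is -1: the convention that
    \<open>binom (-1) 0\<close> is 1 gives exactly the value needed. In the other case the claim is
    upper negation.\<close>
  case 0
  then show ?thesis by (simp add: binom_def)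
next
  case (Suc m)
  then have "int p + int i - 1 = int m" and "of_nat p + of_nat i - 1 = (of_nat m :: 'a)"
    by (linarith, metis add_diff_cancel_right' of_nat_Suc of_nat_add add.commute)
  then show ?thesis
    by (simp add: binom_def gbinomial_minus binomial_gbinomial flip: power_mult_distrib mult.assoc)
qed

text \<open>The binomial series with exponent \<open>-p\<close>, evaluated at \<open>-fps_X\<close>,
  has the signs absorbed into \<open>binom\<close>; substituting \<open>u\<close> is legitimate
  because its constant term vanishes.\<close>

lemma fps_inverse_one_minus_power:
  fixes u :: "'a::field_char_0 fps"
  assumes "u $ 0 = 0"
  shows "inverse ((1 - u) ^ p) = Abs_fps (\<lambda>i. of_nat (binom (int p + int i - 1) i)) oo u"
proof -
  have neg: "fps_const (-1) * fps_X = (- fps_X :: 'a fps)"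
    by (simp flip: fps_const_neg)
  have "Abs_fps (\<lambda>i. of_nat (binom (int p + int i - 1) i)) = inverse ((1 - fps_X :: 'a fps) ^ p)"
    using one_minus_fps_X_const_neg_power[of "1::'a" p] fps_compose_linear[of "fps_binomial (- of_nat p :: 'a)" "-1",
        unfolded neg]
    by (simp add: binom_negative_binomial_gbinomial)
  then show ?thesis
    using assms by (simp add: fps_inverse_compose fps_compose_sub_distrib flip: fps_compose_power)
qed

text \<open>Peels off one level of the fraction. The exponent \<open>p\<close> is kept general
  because the \<open>i\<close>-th term of the expansion contains the \<open>i\<close>-th power of
  the inverse of the next level \<open>C\<close>, to which the same step applies; the factor
  \<open>fps_X ^ i\<close> shifts the degree to \<open>n - i\<close>.\<close>

lemma fps_continued_fraction_step_nth:
  fixes C :: "'a::field_char_0 fps"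
  assumes "C $ 0 = 1"
  shows "inverse ((1 - fps_X * (fps_const y / C)) ^ p) $ n =
    (\<Sum>i\<le>n. of_nat (binom (int p + int i - 1) i) * y ^ i * inverse (C ^ i) $ (n - i))"
proof -
  have "(fps_X * (fps_const y / C)) ^ i $ n = y ^ i * inverse (C ^ i) $ (n - i)" if "i \<le> n" for i
    using assms that
    by (simp add: fps_divide_unit power_mult_distrib fps_X_power_mult_nth
        fps_inverse_power)
  then show ?thesis
    by (simp add: fps_inverse_one_minus_power fps_compose_nth atLeast0AtMost mult.assoc)
qed

text \<open>The innermost level is the case \<open>C = 1\<close>, where only the term
  \<open>i = n\<close> survives.\<close>

lemma fps_inverse_one_minus_const_X_power_nth:
  fixes y :: "'a::field_char_0"
  shows "inverse ((1 - fps_X * fps_const y) ^ p) $ n = of_nat (binom (int p + int n - 1) n) * y ^ n"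
proof -
  have "inverse ((1 - fps_X * fps_const y) ^ p) $ n =
      (\<Sum>i\<le>n. of_nat (binom (int p + int i - 1) i) * y ^ i * (1 :: 'a fps) $ (n - i))"
    using fps_continued_fraction_step_nth[of "1 :: 'a fps" y p n] by simp
  also have "\<dots> = (\<Sum>i\<in>{n}. of_nat (binom (int p + int i - 1) i) * y ^ i)"
    by (intro sum.mono_neutral_cong_right) auto
  finally show ?thesis by simp
qed

lemma finite_triples_sum_eq: "finite {(p, q, l). p + q + l = (n::nat)}"
  by (rule finite_subset[of _ "{..n} \<times> {..n} \<times> {..n}"]) auto

lemma fps_continued_fraction_nth:
  fixes a y1 y2 y3 :: "'a::field_char_0"
  shows "(fps_const a / (1 - fps_X * (fps_const y1 / (1 - fps_X * (fps_const y2 /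
           (1 - fps_X * fps_const y3)))))) $ n =
    (\<Sum>(p, q, l) \<in> {(p, q, l). p + q + l = n}.
       of_nat (binom (int p + int q - 1) q * binom (int q + int l - 1) l)
         * (a * y1 ^ p * y2 ^ q * y3 ^ l))"
proof -
  define A where "A = 1 - fps_X * fps_const y3"
  define C where "C = 1 - fps_X * (fps_const y2 / A)"
  have A0: "A $ 0 = 1" and C0: "C $ 0 = 1" by (simp_all add: A_def C_def)
  let ?t = "\<lambda>p q l. of_nat (binom (int p + int q - 1) q * binom (int q + int l - 1) l)
         * (a * y1 ^ p * y2 ^ q * y3 ^ l)"
  \<comment> \<open>The outermost level has exponent 1, so its binomial factor is trivial; this is
    why the triple sum carries two binomials for three levels.\<close>
  have one: "binom (int i) i = 1" for i by (simp add: binom_def)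
  have "(fps_const a / (1 - fps_X * (fps_const y1 / C))) $ n
      = a * inverse ((1 - fps_X * (fps_const y1 / C)) ^ 1) $ n"
    by (simp add: fps_divide_unit)
  also have "\<dots> = (\<Sum>p\<le>n. \<Sum>q\<le>n - p. ?t p q (n - p - q))"
    unfolding fps_continued_fraction_step_nth[OF C0]
    by (simp add: C_def fps_continued_fraction_step_nth[OF A0] one sum_distrib_left mult_ac)
       (simp add: A_def fps_inverse_one_minus_const_X_power_nth mult_ac)
  also have "\<dots> = (\<Sum>(p, q) \<in> Sigma {..n} (\<lambda>p. {..n - p}). ?t p q (n - p - q))"
    by (rule sum.Sigma) auto
  \<comment> \<open>The innermost index is forced by the total degree:
    \<open>l = n - p - q\<close>.\<close>
  also have "\<dots> = (\<Sum>(p, q, l) \<in> {(p, q, l). p + q + l = n}. ?t p q l)"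
    by (rule sum.reindex_bij_witness[where j = "\<lambda>(p, q). (p, q, n - p - q)" and i = "\<lambda>(p, q, l). (p, q)"])
       auto
  finally show ?thesis by (simp add: A_def C_def)
qed

section \<open>Linear recurrence and rational generating function\<close>

lemma linear_recurrence_of_exchange_relation:
  fixes x :: "nat \<Rightarrow> 'a::field"
  assumes rec: "\<And>n. n \<ge> 1 \<Longrightarrow> x (n + 1) * x (n - 1) = x n ^ 2 + 1"
    and nz: "\<And>n. x n \<noteq> 0"
  shows "x (n + 2) + x n = (x 1 / x 0 + 1 / (x 0 * x 1) + x 0 / x 1) * x (n + 1)"
proof (induction n)
  case 0
  have x2: "x (Suc (Suc 0)) = (x 1 ^ 2 + 1) / x 0"
    using rec[of 1] nz[of 0] by (simp add: field_simps numeral_2_eq_2)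
  show ?case
    using nz[of 0] nz[of 1] by (simp add: x2 field_simps power2_eq_square)
next
  case (Suc n)
  define K where "K = x 1 / x 0 + 1 / (x 0 * x 1) + x 0 / x 1"
  have IH: "x (n + 2) = K * x (n + 1) - x n"
    using Suc unfolding K_def by (simp add: algebra_simps)
  have r1: "x (n + 2) * x n = x (n + 1) ^ 2 + 1" using rec[of "n + 1"] by simp
  have r2: "x (n + 3) * x (n + 1) = x (n + 2) ^ 2 + 1" using rec[of "n + 2"] by (simp add: numeral_3_eq_3)
  \<comment> \<open>By two consecutive exchange relations, both sides equal
    \<open>x (n + 1) ^ 2 + x (n + 2) ^ 2 + 1\<close>.\<close>
  have "(x (n + 3) + x (n + 1)) * x (n + 1) = x (n + 2) * (x (n + 2) + x n)"
    using r1 r2 by (simp add: algebra_simps power2_eq_square)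
  also have "\<dots> = K * x (n + 2) * x (n + 1)"
    by (subst IH) (simp add: algebra_simps IH)
  finally have "x (n + 3) + x (n + 1) = K * x (n + 2)"
    using nz by simp
  then show ?case by (simp add: K_def numeral_3_eq_3)
qed

text \<open>Clearing denominators from the inside out writes the fraction as \<open>x 0\<close>
  times a linear polynomial \<open>C * A\<close> over a quadratic one \<open>D * (C * A)\<close>.
  The latter is the characteristic polynomial of the recurrence, read backwards.\<close>

lemma fps_continued_fraction_of_linear_recurrence:
  fixes x :: "nat \<Rightarrow> 'a::field"
  assumes rec: "\<And>n. x (n + 2) + x n = (y1 + y2 + y3) * x (n + 1)"
    and x1: "x 1 = y1 * x 0" and y13: "y1 * y3 = 1"
  shows "Abs_fps x = fps_const (x 0) / (1 - fps_X * (fps_const y1 / (1 - fps_X * (fps_const y2 /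
           (1 - fps_X * fps_const y3)))))"
proof -
  define A where "A = 1 - fps_X * fps_const y3"
  define C where "C = 1 - fps_X * (fps_const y2 / A)"
  define D where "D = 1 - fps_X * (fps_const y1 / C)"
  \<comment> \<open>Constant term 1 makes all three denominators units, so the divisions are
    genuine.\<close>
  have [simp]: "A $ 0 = 1" "C $ 0 = 1" "D $ 0 = 1" by (simp_all add: A_def C_def D_def)
  have cancel: "f / g * g = f" if "g $ 0 = 1" for f g :: "'a fps"
    using that by (simp add: fps_divide_unit mult.assoc inverse_mult_eq_1)
  have CA: "C * A = A - fps_X * fps_const y2"
    using cancel[of A "fps_const y2"] by (simp add: C_def left_diff_distrib mult.assoc)
  have DC: "D * C = C - fps_X * fps_const y1"
    using cancel[of C "fps_const y1"] by (simp add: D_def left_diff_distrib mult.assoc)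
  have "D * (C * A) = C * A - fps_X * fps_const y1 * A"
    unfolding mult.assoc[symmetric] DC by (simp add: left_diff_distrib)
  also have "\<dots> = 1 - fps_const (y1 + y2 + y3) * fps_X + fps_const (y1 * y3) * fps_X ^ 2"
    unfolding CA by (simp add: A_def algebra_simps power2_eq_square flip: fps_const_add fps_const_mult)
  finally have DCA: "D * (C * A) = 1 - fps_const (y1 + y2 + y3) * fps_X + fps_X ^ 2"
    by (simp add: y13)
  have "Abs_fps x * (D * (C * A)) = fps_const (x 0) * (C * A)"
  proof (rule fps_ext)
    fix n
    have L: "Abs_fps x * (D * (C * A)) =
        Abs_fps x - fps_const (y1 + y2 + y3) * (fps_X * Abs_fps x) + fps_X ^ 2 * Abs_fps x"
      unfolding DCA by (simp add: algebra_simps)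
    have R: "fps_const (x 0) * (C * A) =
        fps_const (x 0) - fps_const (x 0 * (y2 + y3)) * fps_X"
      unfolding CA by (simp add: A_def algebra_simps flip: fps_const_add fps_const_mult)
    show "(Abs_fps x * (D * (C * A))) $ n = (fps_const (x 0) * (C * A)) $ n"
    proof (cases n)
      case 0
      then show ?thesis by (simp add: L R fps_X_power_mult_nth)
    next
      case (Suc m)
      \<comment> \<open>Degree 1 compares \<open>x 1 - (y1 + y2 + y3) * x 0\<close> with
        \<open>- x 0 * (y2 + y3)\<close>, hence uses \<open>x 1 = y1 * x 0\<close>; from degree 2
        on, both sides vanish, the left one by the recurrence.\<close>
      show ?thesis
      proof (cases m)
        case 0
        with Suc show ?thesis using x1 unfolding L R by (simp add: fps_X_power_mult_right_nth algebra_simps)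
      next
        case (Suc k)
        with \<open>n = Suc m\<close> rec[of k] show ?thesis
          unfolding L R by (simp add: fps_X_power_mult_right_nth algebra_simps)
      qed
    qed
  qed
  then have "Abs_fps x * D * (C * A) = fps_const (x 0) * (C * A)"
    by (simp add: mult.assoc)
  moreover have "C * A \<noteq> 0"
    by (metis \<open>A $ 0 = 1\<close> \<open>C $ 0 = 1\<close> fps_mult_nth_0 fps_zero_nth mult_1 zero_neq_one)
  ultimately have "Abs_fps x * D = fps_const (x 0)" by simp
  then have "Abs_fps x = fps_const (x 0) / D"
    by (metis \<open>D $ 0 = 1\<close> fps_zero_nth nonzero_mult_div_cancel_right zero_neq_one)
  then show ?thesis by (simp add: A_def C_def D_def)
qed

section \<open>Laurent monomials, convergence and positivity\<close>

lemma continued_fraction_monomial_powi: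
  fixes a b :: "'a::field"
  assumes "a \<noteq> 0" "b \<noteq> 0"
  shows "a * (b / a) ^ p * (1 / (a * b)) ^ q * (a / b) ^ l
    = a powi (1 + int l - int p - int q) * b powi (int p - int q - int l)"
  using assms
  by (simp add: power_int_add power_int_diff power_divide power_mult_distrib mult_ac)

text \<open>Convergence of power series is coefficientwise, and only the finitely many indices of
  degree \<open>n\<close> affect the \<open>n\<close>-th coefficient: it is exact once a finite
  partial sum includes them all.\<close>

lemma has_sum_fps_homogeneous:
  fixes c :: "'b \<Rightarrow> 'a::comm_ring_1" and F :: "'a fps"
  assumes fin: "\<And>n. finite {t. d t = n}"
    and F: "\<And>n. F $ n = (\<Sum>t | d t = n. c t)"
  shows "((\<lambda>t. fps_const (c t) * fps_X ^ d t) has_sum F) UNIV"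
  unfolding has_sum_def
proof (rule tendsto_fpsI)
  fix n
  have "(\<Sum>t\<in>T. fps_const (c t) * fps_X ^ d t) $ n = F $ n" if "finite T" "{t. d t = n} \<subseteq> T" for T
  proof -
    have "(\<Sum>t\<in>T. fps_const (c t) * fps_X ^ d t) $ n = (\<Sum>t\<in>T. if d t = n then c t else 0)"
      by (auto simp: fps_sum_nth fps_X_power_iff intro!: sum.cong)
    also have "\<dots> = (\<Sum>t | d t = n. c t)"
      using that by (intro sum.mono_neutral_cong_right) auto
    finally show ?thesis by (simp add: F)
  qed
  then show "eventually (\<lambda>T. (\<Sum>t\<in>T. fps_const (c t) * fps_X ^ d t) $ n = F $ n) (finite_subsets_at_top UNIV)"
    using fin by (auto simp: eventually_finite_subsets_at_top)
qed

text \<open>The definition wants one coefficient per exponent pair, whereas \<open>g\<close> may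
  repeat pairs; adding \<open>a\<close> over each fibre of \<open>g\<close> collects like terms and
  preserves non-negativity.\<close>

lemma nonneg_int_Laurent_poly_sum:
  fixes a :: "'b \<Rightarrow> int" and g :: "'b \<Rightarrow> int \<times> int"
  assumes fin: "finite T" and nn: "\<And>t. t \<in> T \<Longrightarrow> a t \<ge> 0"
  shows "nonneg_int_Laurent_poly (\<Sum>t\<in>T. of_int (a t) * X0 powi fst (g t) * X1 powi snd (g t))"
proof -
  define c where "c k = (\<Sum>t | t \<in> T \<and> g t = k. a t)" for k
  have supp: "{k. c k \<noteq> 0} \<subseteq> g ` T"
  proof
    fix k assume "k \<in> {k. c k \<noteq> 0}"
    then have "{t. t \<in> T \<and> g t = k} \<noteq> {}" unfolding c_def by force
    then show "k \<in> g ` T" by blast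
  qed
  have "(\<Sum>t\<in>T. of_int (a t) * X0 powi fst (g t) * X1 powi snd (g t))
     = (\<Sum>k\<in>g ` T. \<Sum>t | t \<in> T \<and> g t = k. of_int (a t) * X0 powi fst (g t) * X1 powi snd (g t))"
    by (rule sum.image_gen[OF fin])
  also have "\<dots> = (\<Sum>k\<in>g ` T. of_int (c k) * X0 powi fst k * X1 powi snd k)"
    by (simp add: c_def sum_distrib_right)
  also have "\<dots> = (\<Sum>(i, j) \<in> {k. c k \<noteq> 0}. of_int (c (i, j)) * X0 powi i * X1 powi j)"
    using fin supp by (intro sum.mono_neutral_cong_right) auto
  finally have "(\<Sum>t\<in>T. of_int (a t) * X0 powi fst (g t) * X1 powi snd (g t)) = \<dots>" .
  moreover have "finite {k. c k \<noteq> 0}" using fin supp finite_subset by blast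
  moreover have "c k \<ge> 0" for k unfolding c_def using nn by (intro sum_nonneg) auto
  ultimately show ?thesis unfolding nonneg_int_Laurent_poly_def by blast
qed

section \<open>The sequence in the field of rational functions\<close>

lemma X0_nonzero: "X0 \<noteq> 0" and X1_nonzero: "X1 \<noteq> 0"
  by (simp_all add: X0_def X1_def Zero_fract_def eq_fract)

theorem mainTheorem1:
  fixes x :: "nat \<Rightarrow> ratfun2" and y1 y2 y3 :: ratfun2
  assumes "x 0 = X0" and "x 1 = X1"
    and "\<And>n. n \<ge> 1 \<Longrightarrow> x (n + 1) * x (n - 1) = x n ^ 2 + 1"
    and "y1 = x 1 / x 0" and "y2 = 1 / (x 0 * x 1)" and "y3 = x 0 / x 1"
  shows "Abs_fps x =
           fps_const (x 0) /
             (1 - fps_X * (fps_const y1 /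
               (1 - fps_X * (fps_const y2 /
                 (1 - fps_X * fps_const y3))))) \<and>
         ((\<lambda>(p, q, l).
             fps_const (of_nat (binom (int p + int q - 1) q * binom (int q + int l - 1) l))
             * fps_X ^ (p + q + l)
             * fps_const (x 0 powi (1 + int l - int p - int q)
                          * x 1 powi (int p - int q - int l)))
           has_sum Abs_fps x) UNIV \<and>
         (\<forall>n. nonneg_int_Laurent_poly (x n))"
proof -
  have nz: "x n \<noteq> 0" for n
  proof (cases "n \<le> 1")
    case True
    then show ?thesis using assms(1,2) X0_nonzero X1_nonzero by (cases n) auto
  next
    case False
    have "x (n - 1) ^ 2 + 1 > 0" by (simp add: add_nonneg_pos)
    \<comment> \<open>\<open>x n\<close> is a factor of a positive element, hence nonzero.\<close>
    moreover have "x n * x (n - 2) = x (n - 1) ^ 2 + 1"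
      using assms(3)[of "n - 1"] False by (simp add: numeral_2_eq_2 Suc_diff_Suc)
    ultimately show ?thesis by force
  qed
  have cf: "Abs_fps x = fps_const (x 0) / (1 - fps_X * (fps_const y1 / (1 - fps_X * (fps_const y2 /
           (1 - fps_X * fps_const y3)))))"
  proof (rule fps_continued_fraction_of_linear_recurrence)
    show "x (n + 2) + x n = (y1 + y2 + y3) * x (n + 1)" for n
      unfolding assms(4-6) by (rule linear_recurrence_of_exchange_relation[OF assms(3) nz])
  qed (use nz in \<open>simp_all add: assms(4,6)\<close>)
  \<comment> \<open>For an index triple, \<open>b\<close> is the coefficient, \<open>g\<close> the
    exponent pair, \<open>d\<close> the degree in \<open>fps_X\<close> and \<open>M\<close> the
    Laurent monomial.\<close>
  define b where "b = (\<lambda>(p, q, l). binom (int p + int q - 1) q * binom (int q + int l - 1) l)"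
  define g where "g = (\<lambda>(p, q, l). (1 + int l - int p - int q, int p - int q - int l))"
  define d :: "nat \<times> nat \<times> nat \<Rightarrow> nat" where "d = (\<lambda>(p, q, l). p + q + l)"
  define M where "M t = x 0 powi fst (g t) * x 1 powi snd (g t)" for t
  have M: "x 0 * y1 ^ p * y2 ^ q * y3 ^ l = M (p, q, l)" for p q l
    using continued_fraction_monomial_powi[OF nz nz, of 0 1 p q l]
    by (simp only: M_def g_def assms(4-6) prod.case fst_conv snd_conv)
  have fin: "finite {t. d t = n}" for n
    using finite_triples_sum_eq[of n] by (simp add: d_def case_prod_beta')
  have coeff: "x n = (\<Sum>t | d t = n. of_nat (b t) * M t)" for n
  proof -
    have "x n = Abs_fps x $ n" by simp
    also have "\<dots> = (\<Sum>(p, q, l) \<in> {(p, q, l). p + q + l = n}.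
       of_nat (binom (int p + int q - 1) q * binom (int q + int l - 1) l) * M (p, q, l))"
      unfolding cf fps_continued_fraction_nth M ..
    also have "\<dots> = (\<Sum>t | d t = n. of_nat (b t) * M t)"
      by (rule sum.cong) (auto simp: d_def b_def)
    finally show ?thesis .
  qed
  have "((\<lambda>t. fps_const (of_nat (b t) * M t) * fps_X ^ d t) has_sum Abs_fps x) UNIV"
    by (rule has_sum_fps_homogeneous) (use fin coeff in auto)
  also have "(\<lambda>t. fps_const (of_nat (b t) * M t) * fps_X ^ d t) = (\<lambda>(p, q, l).
             fps_const (of_nat (binom (int p + int q - 1) q * binom (int q + int l - 1) l))
             * fps_X ^ (p + q + l)
             * fps_const (x 0 powi (1 + int l - int p - int q)
                          * x 1 powi (int p - int q - int l)))"
    by (auto simp: b_def M_def g_def d_def mult_ac simp flip: fps_const_mult)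
  finally have hs: "(\<dots> has_sum Abs_fps x) UNIV" .
  \<comment> \<open>By \<open>coeff\<close>, \<open>x n\<close> is a finite sum of Laurent monomials
    weighted by the natural numbers \<open>b t\<close>.\<close>
  have "nonneg_int_Laurent_poly (x n)" for n
    using nonneg_int_Laurent_poly_sum[OF fin, of n "\<lambda>t. int (b t)" g]
    by (simp add: coeff[of n] M_def assms(1,2)[unfolded One_nat_def] mult.assoc)
  with cf hs show ?thesis by blast
qed

end
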